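(* Let $T,V,\alpha,\Omega,G$ satisfy the Standing Assumption (G). Let $\mathcal U\subsetneqq\mathcal O\subseteq\mathbb{C}$ and let $(\varphi_\kappa)_{\kappa\in\mathcal O}$ be holomorphic functions $\varphi_\kappa:\Omega\to\mathbb{C}$ with $|\varphi_\kappa(z)|\le A(\kappa)e^{B(\kappa)|z|}$ for $z\in\Omega$, where $A(\kappa),B(\kappa)\ge0$ depend continuously on $\kappa$. Let $$F_n(z)=\sum_{l=0}^nC_l(n)\varphi_{\kappa_l(n)}(z),\qquad z\in\Omega,$$ with $C_l(n)\in\mathbb{C}$, $\kappa_l(n)\in\mathcal U$, and suppose that for some $\kappa\in\mathcal O\setminus\mathcal U$ and $C\ge0$, $$\lim_{n\to\infty}\sup_{z\in\Omega}|F_n(z)-\varphi_\kappa(z)|e^{-C|z|}=0.$$ Then $$\lim_{n\to\infty}\Psi(t,x;F_n)=\lim_{n\to\infty}\sum_{l=0}^nC_l(n)\Psi(t,x;\varphi_{\kappa_l(n)})=\Psi(t,x;\varphi_\kappa)$$ uniformly on compact subsets of $[0,T)\times\mathbb{R}$.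
   Context: Double sector: $S_\alpha:=\{0\}\cup\{z\ne0:\mathrm{Arg}(z)\in[0,\alpha]\cup[\pi,\pi+\alpha]\}$, $\mathrm{Arg}\in[0,2\pi)$. $\mathrm{AC}_{1,2}((0,T)\times\mathbb{R})$: functions $\Psi$ with $\Psi(\cdot,x)$ absolutely continuous on $(0,T)$ for all $x$ and $\Psi(t,\cdot),\partial_x\Psi(t,\cdot)$ absolutely continuous on $\mathbb{R}$ for all $t$. Standing Assumption (G): $T\in(0,\infty]$, $V:(0,T)\times\mathbb{R}\to\mathbb{C}$, $\alpha\in(0,\frac\pi2)$, $\Omega\supseteq S_\alpha$ open, $G:(0,T)\times\mathbb{R}\times\Omega\to\mathbb{C}$ holomorphic in $z$, such that: (i) for every $z\in S_\alpha$, $G(\cdot,\cdot,z)\in\mathrm{AC}_{1,2}$ and $i\partial_tG=(-\partial_x^2+V)G$ a.e.; (ii) there is an absolutely continuous $a:(0,T)\to(0,\infty)$ with $a(t)\to\infty$ as $t\to0^+$ such that $G(t,x,z)=e^{ia(t)(z-x)^2}\widetilde G(t,x,z)$ with $|\widetilde G(t,x,z)|\le A_0(t,x)e^{B_0(t,x)|z|}$ on $(0,T)\times\mathbb{R}\times\Omega$, $A_0,B_0\ge0$ continuous, and $A_0/\sqrt a$, $B_0$ extending continuously to $[0,T)\times\mathbb{R}$; (iii) $\lim_{t\to0^+}\widetilde G(t,x,z)/\sqrt{a(t)}=1/\sqrt{i\pi}$ for all $x,z$; (iv) $|\partial_x\widetilde G|,|\partial_x^2\widetilde G|,|\partial_t\widetilde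 G|\le A_1(t,x)e^{B_1(t,x)|z|}$ for $z\in S_\alpha$, with $A_1\ge0$ locally integrable and $B_1\ge0$ continuous. For $F$ holomorphic on $\Omega$ with an exponential bound $|F(z)|\le Ae^{B|z|}$, $\Psi(t,x;F):=\lim_{\varepsilon\to0^+}\int_{\mathbb{R}}e^{-\varepsilon y^2}G(t,x,y)F(y)dy$ for $t\in(0,T)$, and $\Psi(0,x;F):=F(x)$. *)

theory Defs
  imports "HOL-Analysis.Analysis"
begin

definition arg02 :: "complex \<Rightarrow> real" where
  "arg02 z = (if Arg z < 0 then Arg z + 2 * pi else Arg z)"

definition double_sector :: "real \<Rightarrow> complex set" where
  "double_sector \<alpha> = {0} \<union> {z. z \<noteq> 0 \<and> (arg02 z \<in> {0..\<alpha>} \<or> arg02 z \<in> {pi..pi + \<alpha>})}"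

definition ac_on :: "real set \<Rightarrow> (real \<Rightarrow> 'a::real_normed_vector) \<Rightarrow> bool" where
  "ac_on I f \<longleftrightarrow> (\<forall>\<epsilon>>0. \<exists>\<delta>>0. \<forall>(n::nat) (a::nat \<Rightarrow> real) (b::nat \<Rightarrow> real).
      ((\<forall>k<n. a k \<le> b k \<and> {a k..b k} \<subseteq> I) \<and>
       (\<forall>j<n. \<forall>k<n. j \<noteq> k \<longrightarrow> {a j<..<b j} \<inter> {a k<..<b k} = {}) \<and>
       (\<Sum>k<n. b k - a k) < \<delta>)
      \<longrightarrow> (\<Sum>k<n. norm (f (b k) - f (a k))) < \<epsilon>)"

definition loc_ac_on :: "real set \<Rightarrow> (real \<Rightarrow> 'a::real_normed_vector) \<Rightarrow> bool" where
  "loc_ac_on I f \<longleftrightarrow> (\<forall>c d. {c..d} \<subseteq> I \<longrightarrow> ac_on {c..d} f)"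

definition strip :: "ereal \<Rightarrow> (real \<times> real) set" where
  "strip T = {p. 0 < fst p \<and> ereal (fst p) < T}"

definition cstrip :: "ereal \<Rightarrow> (real \<times> real) set" where
  "cstrip T = {p. 0 \<le> fst p \<and> ereal (fst p) < T}"

definition AC12 :: "ereal \<Rightarrow> (real \<Rightarrow> real \<Rightarrow> complex) \<Rightarrow> (real \<Rightarrow> real \<Rightarrow> complex) \<Rightarrow> bool" where
  "AC12 T P Px \<longleftrightarrow>
     (\<forall>x. loc_ac_on {t. 0 < t \<and> ereal t < T} (\<lambda>t. P t x)) \<and>
     (\<forall>t. 0 < t \<and> ereal t < T \<longrightarrow>
        loc_ac_on UNIV (\<lambda>x. P t x) \<and>
        (\<forall>x. ((\<lambda>y. P t y) has_vector_derivative Px t x) (at x)) \<and>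
        loc_ac_on UNIV (\<lambda>x. Px t x))"

definition standing_G ::
  "ereal \<Rightarrow> (real \<Rightarrow> real \<Rightarrow> complex) \<Rightarrow> real \<Rightarrow> complex set
     \<Rightarrow> (real \<Rightarrow> real \<Rightarrow> complex \<Rightarrow> complex) \<Rightarrow> bool" where
  "standing_G T V \<alpha> \<Omega> G \<longleftrightarrow>
     T > 0 \<and> 0 < \<alpha> \<and> \<alpha> < pi / 2 \<and> open \<Omega> \<and> double_sector \<alpha> \<subseteq> \<Omega> \<and>
     (\<forall>t x. (t, x) \<in> strip T \<longrightarrow> (G t x) holomorphic_on \<Omega>) \<and>
     \<comment> \<open>(i)\<close>
     (\<forall>z \<in> double_sector \<alpha>. \<exists>Gx.
        AC12 T (\<lambda>t x. G t x z) Gx \<and>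
        (\<exists>N. N \<in> null_sets (lborel :: (real \<times> real) measure) \<and>
           (\<forall>t x. (t, x) \<in> strip T - N \<longrightarrow>
              (\<exists>dt dxx. ((\<lambda>s. G s x z) has_vector_derivative dt) (at t) \<and>
                        ((\<lambda>y. Gx t y) has_vector_derivative dxx) (at x) \<and>
                        \<i> * dt = - dxx + V t x * G t x z)))) \<and>
     \<comment> \<open>(ii)--(iv)\<close>
     (\<exists>(a :: real \<Rightarrow> real) Gt A0 B0 A1 B1.
        (\<forall>t. 0 < t \<and> ereal t < T \<longrightarrow> a t > 0) \<and>
        loc_ac_on {t. 0 < t \<and> ereal t < T} a \<and>
        filterlim a at_top (at_right 0) \<and>
        \<comment> \<open>(ii)\<close>
        (\<forall>t x z. (t, x) \<in> strip T \<and> z \<in> \<Omega> \<longrightarrow>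
           G t x z = exp (\<i> * complex_of_real (a t) * (z - complex_of_real x)\<^sup>2) * Gt t x z \<and>
           norm (Gt t x z) \<le> A0 t x * exp (B0 t x * norm z)) \<and>
        (\<forall>t x. (t, x) \<in> strip T \<longrightarrow> A0 t x \<ge> 0 \<and> B0 t x \<ge> 0) \<and>
        continuous_on (strip T) (\<lambda>(t, x). A0 t x) \<and>
        continuous_on (strip T) (\<lambda>(t, x). B0 t x) \<and>
        (\<exists>A0' :: real \<times> real \<Rightarrow> real. continuous_on (cstrip T) A0' \<and>
           (\<forall>t x. (t, x) \<in> strip T \<longrightarrow> A0' (t, x) = A0 t x / sqrt (a t))) \<and>
        (\<exists>B0' :: real \<times> real \<Rightarrow> real. continuous_on (cstrip T) B0' \<and>
           (\<forall>t x. (t, x) \<in> strip T \<longrightarrow> B0' (t, x) = B0 t x)) \<and>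
        \<comment> \<open>(iii)\<close>
        (\<forall>x. \<forall>z \<in> \<Omega>. ((\<lambda>t. Gt t x z / complex_of_real (sqrt (a t)))
              \<longlongrightarrow> 1 / csqrt (\<i> * complex_of_real pi)) (at_right 0)) \<and>
        \<comment> \<open>(iv): bounds on the derivatives wherever they exist\<close>
        (\<forall>t x. (t, x) \<in> strip T \<longrightarrow> A1 t x \<ge> 0 \<and> B1 t x \<ge> 0) \<and>
        (\<forall>K. compact K \<and> K \<subseteq> strip T \<longrightarrow>
           set_integrable lborel K (\<lambda>(t, x). A1 t x)) \<and>
        continuous_on (strip T) (\<lambda>(t, x). B1 t x) \<and>
        (\<forall>z \<in> double_sector \<alpha>. \<forall>t x. (t, x) \<in> strip T \<longrightarrow>
           (\<forall>d. ((\<lambda>y. Gt t y z) has_vector_derivative d) (at x) \<longrightarrow>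
                norm d \<le> A1 t x * exp (B1 t x * norm z)) \<and>
           (\<forall>d. ((\<lambda>s. Gt s x z) has_vector_derivative d) (at t) \<longrightarrow>
                norm d \<le> A1 t x * exp (B1 t x * norm z)) \<and>
           (\<forall>Gtx d. (\<forall>y. ((\<lambda>w. Gt t w z) has_vector_derivative Gtx y) (at y)) \<and>
                   (Gtx has_vector_derivative d) (at x) \<longrightarrow>
                norm d \<le> A1 t x * exp (B1 t x * norm z))))"

definition Psi :: "(real \<Rightarrow> real \<Rightarrow> complex \<Rightarrow> complex) \<Rightarrow> (complex \<Rightarrow> complex)
                   \<Rightarrow> real \<Rightarrow> real \<Rightarrow> complex" where
  "Psi G F t x = (if t = 0 then F (complex_of_real x)
     else Lim (at_right 0) (\<lambda>\<epsilon>::real. LINT y|lborel.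
            complex_of_real (exp (- \<epsilon> * y\<^sup>2)) * G t x (complex_of_real y) * F (complex_of_real y)))"

end

theory Submission
  imports Defs
    "HOL-Probability.Distributions"
    "HOL-Complex_Analysis.Cauchy_Integral_Theorem"
    "HOL-Real_Asymp.Real_Asymp"
begin

text \<open>By linearity it suffices to bound \<open>\<Psi>(t, x; H)\<close> by a locally bounded multiple of \<open>\<delta>\<close> whenever
  \<open>H\<close> is holomorphic on \<open>\<Omega>\<close> with \<open>|H(z)| \<le> \<delta> exp(c|z|)\<close>. The real line is rotated about \<open>x\<close> to
  \<open>{x + s(1 + i m)}\<close>, where \<open>m > 0\<close> is so small that for all \<open>|x| \<le> X\<close> the swept region lies in \<open>\<Omega>\<close>.
  On the rotated line the factor \<open>exp(i a (z - x)\<^sup>2)\<close> has modulus \<open>exp(-2 a m s\<^sup>2)\<close>, so the regularised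
  integrals converge by domination and the limit is \<open>O(\<delta> A\<^sub>0 / sqrt a)\<close>, which stays bounded as \<open>t\<close>
  tends to \<open>0\<close> because \<open>A\<^sub>0 / sqrt a\<close> extends continuously.\<close>

section \<open>Gaussian integrals and integrals over half-lines\<close>

lemma has_bochner_integral_gaussian:
  assumes "\<eta> > 0"
  shows "has_bochner_integral lborel (\<lambda>s::real. exp (- \<eta> * s\<^sup>2)) (sqrt (pi / \<eta>))"
proof -
  \<comment> \<open>The standard deviation at which the exponent of the normal density becomes
    \<open>- \<eta> * s^2\<close>.\<close>
  define \<sigma> where "\<sigma> = 1 / sqrt (2 * \<eta>)"
  have \<sigma>: "\<sigma> > 0" and s2: "\<sigma>\<^sup>2 = 1 / (2 * \<eta>)"
    using assms by (auto simp: \<sigma>_def power_divide)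
  have eq: "exp (- \<eta> * s\<^sup>2) = sqrt (pi / \<eta>) * normal_density 0 \<sigma> s" for s
    using assms by (simp add: normal_density_def s2 real_sqrt_divide)
  have "has_bochner_integral lborel (normal_density 0 \<sigma>) 1"
    using \<sigma> by (simp add: has_bochner_integral_iff)
  from has_bochner_integral_mult_right[OF this, of "sqrt (pi / \<eta>)"]
  show ?thesis unfolding eq by simp
qed

text \<open>Reflection turns the negative half-line into a second ray from \<open>0\<close>, so that
  a statement about a line follows from one about rays in opposite directions.\<close>

lemma integral_halflines:
  fixes f :: "real \<Rightarrow> complex"
  assumes f: "integrable lborel f"
  shows "set_integrable lborel {0..} f" "set_integrable lborel {0..} (\<lambda>s. f (- s))"
    and "(LINT s|lborel. f s) = (LINT s:{0..}|lborel. f s) + (LINT s:{0..}|lborel. f (- s))"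
proof -
  have fm: "integrable lborel (\<lambda>s. f (- s))"
    using lborel_integrable_real_affine[OF f, of "-1" 0] by simp
  show 1: "set_integrable lborel {0..} f" "set_integrable lborel {0..} (\<lambda>s. f (- s))"
    unfolding set_integrable_def using f fm by (auto intro: integrable_mult_indicator)
  have 2: "set_integrable lborel {..<0} f"
    unfolding set_integrable_def using f by (auto intro: integrable_mult_indicator)
  have "(LINT s|lborel. f s) = (LINT s:UNIV|lborel. f s)"
    by (simp add: set_lebesgue_integral_def)
  also have "UNIV = {0..} \<union> {..<0::real}" by auto
  also have "(LINT s:{0..} \<union> {..<0}|lborel. f s) = (LINT s:{0..}|lborel. f s) + (LINT s:{..<0}|lborel. f s)"
    using 1 2 by (intro set_integral_Un) auto
  also have "(LINT s:{..<0}|lborel. f s) = (LINT s|lborel. indicator {..<0} (- s) *\<^sub>R f (- s))"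
    unfolding set_lebesgue_integral_def
    by (subst lborel_integral_real_affine[of "-1" _ 0]) auto
  also have "\<dots> = (LINT s:{0..}|lborel. f (- s))"
    unfolding set_lebesgue_integral_def
  proof (rule integral_cong_AE)
    \<comment> \<open>The two indicators differ only at \<open>s = 0\<close>.\<close>
    show "AE s in lborel. indicator {..<0} (- s) *\<^sub>R f (- s) = indicator {0..} s *\<^sub>R f (- s)"
      using AE_lborel_singleton[of 0] by eventually_elim (auto simp: indicator_def)
    show "(\<lambda>s. indicator {..<0} (- s) *\<^sub>R f (- s)) \<in> borel_measurable lborel"
         "(\<lambda>s. indicator {0..} s *\<^sub>R f (- s)) \<in> borel_measurable lborel"
      using fm by (auto intro!: borel_measurable_scaleR dest: borel_measurable_integrable)
  qed
  finally show "(LINT s|lborel. f s) = (LINT s:{0..}|lborel. f s) + (LINT s:{0..}|lborel. f (- s))" .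
qed

section \<open>Rotating rays and lines by Cauchy's theorem\<close>

text \<open>Writing the contour integral over a segment as a Lebesgue integral over
  \<open>{0..R}\<close> allows \<open>R\<close> to tend to infinity with the integrand fixed. The
  direction \<open>u\<close> need not have norm 1.\<close>

lemma has_contour_integral_linepath_direction:
  assumes R: "R > 0" and cont: "continuous_on (closed_segment p (p + of_real R * u)) g"
  shows "(g has_contour_integral u * (LINT s:{0..R}|lborel. g (p + of_real s * u)))
           (linepath p (p + of_real R * u))"
proof -
  have mem: "p + of_real s * u \<in> closed_segment p (p + of_real R * u)" if "s \<in> {0..R}" for s
    using that R by (auto simp: in_segment algebra_simps scaleR_conv_of_real intro!: exI[of _ "s / R"])
  have co: "continuous_on {0..R} (\<lambda>s. g (p + of_real s * u))"
    by (rule continuous_on_compose2[OF cont]) (auto intro!: continuous_intros mem)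
  have "set_integrable lborel {0..R} (\<lambda>s. g (p + of_real s * u))"
    by (rule borel_integrable_atLeastAtMost') (rule co)
  from set_borel_integral_eq_integral[OF this]
  have "((\<lambda>s. g (p + of_real s * u)) has_integral (LINT s:{0..R}|lborel. g (p + of_real s * u))) (cbox 0 R)"
    by (simp add: has_integral_integral)
  \<comment> \<open>Rescaling \<open>{0..R}\<close> to \<open>{0..1}\<close> divides the integral by
    \<open>R\<close>; the factor \<open>R * u\<close>, the velocity of \<open>linepath\<close>,
    makes up for it.\<close>
  from has_integral_mult_right[OF has_integral_affinity'[OF this R, of 0], of "of_real R * u"]
  have "((\<lambda>s. of_real R * u * g (p + of_real (R * s) * u)) has_integral
          u * (LINT s:{0..R}|lborel. g (p + of_real s * u))) {0..1}"
    using R by (simp add: scaleR_conv_of_real field_simps)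
  moreover have "linepath p (p + of_real R * u) s = p + of_real (R * s) * u" for s
    by (simp add: linepath_def scaleR_conv_of_real algebra_simps)
  ultimately show ?thesis
    by (simp add: has_contour_integral_linepath mult_ac)
qed

text \<open>Cauchy's theorem on the triangle \<open>p\<close>, \<open>p + R u\<close>,
  \<open>p + R v\<close>. The far side is a chord of length \<open>R * norm (v - u)\<close> on which
  \<open>g\<close> is at most \<open>\<beta> R\<close>, so its contribution vanishes in the limit by
  \<open>lim\<close>.\<close>

lemma ray_rotation:
  fixes g :: "complex \<Rightarrow> complex"
  assumes hol: "g holomorphic_on S"
    and cone: "\<And>s \<tau>. s \<ge> 0 \<Longrightarrow> \<tau> \<in> {0..1} \<Longrightarrow> p + of_real s * (of_real (1 - \<tau>) * u + of_real \<tau> * v) \<in> S"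
    and chord: "\<And>s \<tau>. s \<ge> 0 \<Longrightarrow> \<tau> \<in> {0..1} \<Longrightarrow>
        norm (g (p + of_real s * (of_real (1 - \<tau>) * u + of_real \<tau> * v))) \<le> \<beta> s"
    and lim: "((\<lambda>s. s * \<beta> s) \<longlongrightarrow> 0) at_top"
    and iu: "set_integrable lborel {0..} (\<lambda>s. g (p + of_real s * u))"
    and iv: "set_integrable lborel {0..} (\<lambda>s. g (p + of_real s * v))"
  shows "u * (LINT s:{0..}|lborel. g (p + of_real s * u)) = v * (LINT s:{0..}|lborel. g (p + of_real s * v))"
proof -
  define I where "I u R = (LINT s:{0..R}|lborel. g (p + of_real s * u))" for u R
  have bnd: "norm (u * I u R - v * I v R) \<le> (R * \<beta> R) * norm (v - u)" if R: "R > 0" for R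
  proof -
    let ?a = "p + of_real R * u" and ?b = "p + of_real R * v"
    have hull: "convex hull {p, ?a, ?b} \<subseteq> S"
    proof
      fix z assume "z \<in> convex hull {p, ?a, ?b}"
      then obtain r b c where rbc: "0 \<le> r" "0 \<le> b" "0 \<le> c" "r + b + c = 1"
        and z: "z = r *\<^sub>R p + b *\<^sub>R ?a + c *\<^sub>R ?b" by (auto simp: convex_hull_3)
      have z': "z = p + of_real (R * b) * u + of_real (R * c) * v"
      proof -
        have r: "r = 1 - b - c" using rbc by simp
        show ?thesis unfolding z r by (simp add: scaleR_conv_of_real algebra_simps)
      qed
      show "z \<in> S"
      proof (cases "b + c = 0")
        case True
        hence "b = 0" "c = 0" using rbc by auto
        thus ?thesis using cone[of 0 0] z' by simp
      next
        case False
        \<comment> \<open>A point of the triangle other than \<open>p\<close> lies on the chord at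
          scale \<open>R * (b + c)\<close>, and \<tau> is its relative position there.\<close>
        define \<tau> where "\<tau> = c / (b + c)"
        have \<tau>: "\<tau> \<in> {0..1}" using rbc False by (auto simp: \<tau>_def divide_simps)
        have e: "(R * (b + c)) * (1 - \<tau>) = R * b" "(R * (b + c)) * \<tau> = R * c"
          using False by (auto simp: \<tau>_def field_simps)
        have "p + of_real (R * (b + c)) * (of_real (1 - \<tau>) * u + of_real \<tau> * v)
            = p + of_real ((R * (b + c)) * (1 - \<tau>)) * u + of_real ((R * (b + c)) * \<tau>) * v"
          by (simp add: algebra_simps)
        also have "\<dots> = z" unfolding e z' ..
        finally show ?thesis using cone[of "R * (b + c)" \<tau>] \<tau> rbc R by auto
      qed
    qed
    have co: "continuous_on (convex hull {p, ?a, ?b}) g"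
      using holomorphic_on_imp_continuous_on[OF hol] hull continuous_on_subset by blast
    have seg: "closed_segment x y \<subseteq> convex hull {p, ?a, ?b}" if "x \<in> {p, ?a, ?b}" "y \<in> {p, ?a, ?b}" for x y
      unfolding segment_convex_hull using that by (intro hull_mono) auto
    have c1: "(g has_contour_integral u * I u R) (linepath p ?a)"
      unfolding I_def using R
      by (intro has_contour_integral_linepath_direction continuous_on_subset[OF co] seg) simp_all
    have c2: "(g has_contour_integral v * I v R) (linepath p ?b)"
      unfolding I_def using R
      by (intro has_contour_integral_linepath_direction continuous_on_subset[OF co] seg) simp_all
    have "continuous_on (closed_segment ?a ?b) g"
      by (intro continuous_on_subset[OF co] seg) simp_all
    then obtain J where J: "(g has_contour_integral J) (linepath ?a ?b)"
      using contour_integrable_continuous_linepath unfolding contour_integrable_on_def by blast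
    have tri: "(g has_contour_integral 0) (linepath p ?a +++ linepath ?a ?b +++ linepath ?b p)"
      using hol hull by (intro Cauchy_theorem_triangle) (rule holomorphic_on_subset)
    have "(g has_contour_integral (u * I u R + (J + - (v * I v R))))
            (linepath p ?a +++ linepath ?a ?b +++ linepath ?b p)"
      using c1 J has_contour_integral_reverse_linepath[OF c2]
      by (intro has_contour_integral_join) auto
    hence "u * I u R + (J + - (v * I v R)) = 0"
      using tri has_contour_integral_unique by blast
    hence "u * I u R - v * I v R = - J" by (simp add: algebra_simps add_eq_0_iff)
    moreover have "norm J \<le> \<beta> R * norm (?b - ?a)"
    proof (rule has_contour_integral_bound_linepath[OF J])
      show "0 \<le> \<beta> R" using chord[of R 0] R by (auto intro: order_trans[OF norm_ge_zero])
      fix x assume "x \<in> closed_segment ?a ?b"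
      then obtain \<tau> where \<tau>: "0 \<le> \<tau>" "\<tau> \<le> 1" and x: "x = (1 - \<tau>) *\<^sub>R ?a + \<tau> *\<^sub>R ?b"
        by (auto simp: in_segment)
      have "x = p + of_real R * (of_real (1 - \<tau>) * u + of_real \<tau> * v)"
        unfolding x by (simp add: scaleR_conv_of_real algebra_simps)
      thus "norm (g x) \<le> \<beta> R" using chord[of R \<tau>] R \<tau> by simp
    qed
    moreover have "norm (?b - ?a) = R * norm (v - u)"
      using R by (simp add: norm_mult flip: right_diff_distrib)
    ultimately show ?thesis by (simp add: mult_ac)
  qed
  have "((\<lambda>R. u * I u R - v * I v R) \<longlongrightarrow> 0) at_top"
  proof (rule Lim_null_comparison)
    show "\<forall>\<^sub>F R in at_top. norm (u * I u R - v * I v R) \<le> (R * \<beta> R) * norm (v - u)"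
      using eventually_gt_at_top[of 0] by eventually_elim (rule bnd)
    show "((\<lambda>R. R * \<beta> R * norm (v - u)) \<longlongrightarrow> 0) at_top"
      using tendsto_mult_left_zero[OF lim] by auto
  qed
  moreover have "((\<lambda>R. u * I u R - v * I v R) \<longlongrightarrow> u * (LINT s:{0..}|lborel. g (p + of_real s * u)) - v * (LINT s:{0..}|lborel. g (p + of_real s * v))) at_top"
    unfolding I_def by (intro tendsto_intros tendsto_set_lebesgue_integral_at_top iu iv) auto
  ultimately show ?thesis
    using tendsto_unique trivial_limit_at_top_linorder by fastforce
qed

text \<open>A line through \<open>p\<close> is a pair of opposite rays. The ray with negative
  \<open>s\<close> has direction \<open>- u\<close> and is turned to \<open>- v\<close>; subtracting
  the two identities gives the claim.\<close>

lemma line_rotation: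
  fixes g :: "complex \<Rightarrow> complex"
  assumes hol: "g holomorphic_on S"
    and wedge: "\<And>s \<tau>. \<tau> \<in> {0..1} \<Longrightarrow> p + of_real s * (of_real (1 - \<tau>) * u + of_real \<tau> * v) \<in> S"
    and chord: "\<And>s \<tau>. \<tau> \<in> {0..1} \<Longrightarrow>
        norm (g (p + of_real s * (of_real (1 - \<tau>) * u + of_real \<tau> * v))) \<le> \<beta> \<bar>s\<bar>"
    and lim: "((\<lambda>s. s * \<beta> s) \<longlongrightarrow> 0) at_top"
    and iu: "integrable lborel (\<lambda>s. g (p + of_real s * u))"
    and iv: "integrable lborel (\<lambda>s. g (p + of_real s * v))"
  shows "u * (LINT s|lborel. g (p + of_real s * u)) = v * (LINT s|lborel. g (p + of_real s * v))"
proof -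
  note hu = integral_halflines[OF iu] and hv = integral_halflines[OF iv]
  have 1: "u * (LINT s:{0..}|lborel. g (p + of_real s * u)) = v * (LINT s:{0..}|lborel. g (p + of_real s * v))"
  proof (rule ray_rotation[OF hol wedge _ lim])
    fix s \<tau> :: real assume "0 \<le> s" "\<tau> \<in> {0..1}"
    thus "norm (g (p + of_real s * (of_real (1 - \<tau>) * u + of_real \<tau> * v))) \<le> \<beta> s"
      using chord[of \<tau> s] by simp
  qed (use hu hv in simp_all)
  have 2: "(- u) * (LINT s:{0..}|lborel. g (p + of_real s * (- u))) = (- v) * (LINT s:{0..}|lborel. g (p + of_real s * (- v)))"
  proof (rule ray_rotation[OF hol _ _ lim])
    fix s \<tau> :: real assume "0 \<le> s" "\<tau> \<in> {0..1}"
    moreover have "of_real s * (of_real (1 - \<tau>) * (- u) + of_real \<tau> * (- v))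
        = of_real (- s) * (of_real (1 - \<tau>) * u + of_real \<tau> * v)" by (simp add: algebra_simps)
    ultimately show "p + of_real s * (of_real (1 - \<tau>) * (- u) + of_real \<tau> * (- v)) \<in> S"
      "norm (g (p + of_real s * (of_real (1 - \<tau>) * (- u) + of_real \<tau> * (- v)))) \<le> \<beta> s"
      using wedge[of \<tau> "- s"] chord[of \<tau> "- s"] by auto
  qed (use hu hv in simp_all)
  show ?thesis using 1 2 unfolding hu(3) hv(3) by (simp add: algebra_simps)
qed

section \<open>Geometry of the double sector\<close>

text \<open>The sign condition selects the closed first and third quadrants, and the slope condition
  bounds the angle, since in the right half-plane \<open>Arg\<close> is the arctangent of the slope.
  The left half-plane is reduced to \<open>- z\<close>.\<close>

lemma mem_double_sector:
  assumes "0 < \<alpha>" "\<alpha> < pi / 2" "Re z * Im z \<ge> 0" "\<bar>Im z\<bar> \<le> tan \<alpha> * \<bar>Re z\<bar>"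
  shows "z \<in> double_sector \<alpha>"
proof (cases "Re z = 0")
  case True
  hence "z = 0" using assms by (simp add: complex_eq_iff)
  thus ?thesis by (simp add: double_sector_def)
next
  case False
  have arctan_bounds: "0 \<le> arctan (Im w / Re w) \<and> arctan (Im w / Re w) \<le> \<alpha>"
    if w: "Re w > 0" "Im w \<ge> 0" "Im w \<le> tan \<alpha> * Re w" for w
  proof -
    have "Im w / Re w \<le> tan \<alpha>" using w by (simp add: divide_simps)
    hence "arctan (Im w / Re w) \<le> arctan (tan \<alpha>)" by (rule arctan_monotone')
    also have "\<dots> = \<alpha>" using assms by (intro arctan_tan) auto
    finally show ?thesis using w by simp
  qed
  show ?thesis
  proof (cases "Re z > 0")
    case True
    hence "Im z \<ge> 0" using assms by (simp add: zero_le_mult_iff)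
    hence "\<not> Im z / Re z < 0" using True by (simp add: not_less)
    with \<open>Im z \<ge> 0\<close> have "arg02 z \<in> {0..\<alpha>}"
      using arctan_bounds[of z] True assms by (simp add: arg02_def arg_conv_arctan)
    thus ?thesis by (simp add: double_sector_def)
  next
    case neg: False
    hence Re: "Re (- z) > 0" using False by simp
    have Im: "Im (- z) \<ge> 0" using Re assms by (auto simp: zero_le_mult_iff)
    define \<theta> where "\<theta> = Arg (- z)"
    have \<theta>: "0 \<le> \<theta>" "\<theta> \<le> \<alpha>"
      using arctan_bounds[OF Re Im] Re Im assms arg_conv_arctan[OF Re] by (auto simp: \<theta>_def)
    \<comment> \<open>\<open>Arg\<close> jumps at the negative axis: \<theta> = 0 gives
      \<open>pi\<close>, while \<theta> > 0 gives the negative value \<open>\<theta> - pi\<close>,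
      which \<open>arg02\<close> shifts by \<open>2 * pi\<close>. Either way
      \<open>arg02 z = \<theta> + pi\<close>.\<close>
    have "Arg (- (- z)) = (if \<theta> \<le> 0 then \<theta> + pi else \<theta> - pi)"
      unfolding \<theta>_def using False by (intro Arg_minus) auto
    hence "arg02 z \<in> {pi..pi + \<alpha>}"
      using \<theta> assms by (auto simp: arg02_def split: if_splits)
    thus ?thesis by (simp add: double_sector_def)
  qed
qed

lemma of_real_mem_double_sector:
  assumes "0 < \<alpha>" "\<alpha> < pi / 2"
  shows "of_real r \<in> double_sector \<alpha>"
  using mem_double_sector[OF assms, of "of_real r"] tan_gt_zero[of \<alpha>] assms by simp

text \<open>The neighbourhood of a compact real interval contained in \<open>\<Omega>\<close> is what allows a line through
  \<open>x \<noteq> 0\<close>, which leaves the double sector between \<open>0\<close> and \<open>x\<close>.\<close>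

lemma tilted_lines_subset:
  assumes \<alpha>: "0 < \<alpha>" "\<alpha> < pi / 2" and \<Omega>: "open \<Omega>" "double_sector \<alpha> \<subseteq> \<Omega>" and X: "X \<ge> 0"
  obtains m where "0 < m" "m \<le> 1 / 2"
    "\<And>x s \<mu>. \<bar>x\<bar> \<le> X \<Longrightarrow> 0 \<le> \<mu> \<Longrightarrow> \<mu> \<le> m \<Longrightarrow> of_real x + of_real s * Complex 1 \<mu> \<in> \<Omega>"
proof -
  have real: "of_real r \<in> \<Omega>" for r
    using of_real_mem_double_sector[OF \<alpha>] \<Omega> by blast
  \<comment> \<open>If \<bar>x + s\<bar> exceeds \<open>2 * X + 1\<close>, then \<open>s\<close> and
    \<open>x + s\<close> have the same sign and \<bar>s\<bar> is at most twice \<bar>x + s\<bar>,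
    which puts the point into the sector. Otherwise \<bar>s\<bar> is at most
    \<open>3 * X + 1\<close> and the point is close to \<open>I\<close>.\<close>
  define I where "I = (of_real ` {-(2 * X + 1)..2 * X + 1} :: complex set)"
  have "compact I" unfolding I_def by (intro compact_continuous_image continuous_intros) auto
  then obtain d where d: "d > 0" "(\<Union>z\<in>I. ball z d) \<subseteq> \<Omega>"
    using compact_subset_open_imp_ball_epsilon_subset[of I \<Omega>] \<Omega> real by (auto simp: I_def)
  \<comment> \<open>The bound \<open>1 / 2\<close> serves the later Gaussian estimates,
    \<open>tan \<alpha> / 2\<close> makes up for the factor 2 between \<bar>s\<bar> and \<bar>x +
    s\<bar>, and \<open>d / (3 * X + 2)\<close> keeps the height above \<open>I\<close> below
    \<open>d\<close>.\<close>
  define m where "m = Min {1 / 2, tan \<alpha> / 2, d / (3 * X + 2)}"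
  have m: "m \<le> 1 / 2" "m \<le> tan \<alpha> / 2" "m \<le> d / (3 * X + 2)"
    unfolding m_def by (intro Min_le; simp)+
  have m0: "0 < m"
    using \<alpha> d X tan_gt_zero[of \<alpha>] by (simp add: m_def)
  have "of_real x + of_real s * Complex 1 \<mu> \<in> \<Omega>" if x: "\<bar>x\<bar> \<le> X" and \<mu>: "0 \<le> \<mu>" "\<mu> \<le> m" for x s \<mu>
  proof -
    define z where "z = of_real x + of_real s * Complex 1 \<mu>"
    have z: "Re z = x + s" "Im z = s * \<mu>" by (auto simp: z_def)
    show ?thesis
    proof (cases "\<bar>x + s\<bar> \<le> 2 * X + 1")
      case True
      hence s: "\<bar>s\<bar> \<le> 3 * X + 1" using x by linarith
      have "dist (of_real (x + s)) z = \<bar>s\<bar> * \<mu>"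
      proof -
        have "of_real (x + s) - z = \<i> * of_real (- (s * \<mu>))" by (simp add: complex_eq_iff z)
        thus ?thesis using \<mu> by (simp only: dist_norm norm_mult norm_of_real) (simp add: abs_mult)
      qed
      also have "\<dots> \<le> \<bar>s\<bar> * m" using \<mu> by (intro mult_left_mono) auto
      also have "\<dots> \<le> (3 * X + 1) * m" using s m0 by (intro mult_right_mono) auto
      also have "\<dots> < (3 * X + 2) * m" using m0 by simp
      also have "\<dots> \<le> d" using m X by (simp add: field_simps)
      finally have "z \<in> ball (of_real (x + s)) d" by simp
      moreover have "of_real (x + s) \<in> I" using True unfolding I_def by (intro imageI) auto
      ultimately show ?thesis using d unfolding z_def by blast
    next
      case False
      have "0 \<le> Re z * Im z"
        unfolding z using False x \<mu> by (cases "s \<ge> 0") (auto simp: zero_le_mult_iff mult_le_0_iff)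
      moreover have "\<bar>Im z\<bar> \<le> tan \<alpha> * \<bar>Re z\<bar>"
      proof -
        have "\<bar>s * \<mu>\<bar> \<le> \<bar>s\<bar> * (tan \<alpha> / 2)" unfolding abs_mult using \<mu> m by (intro mult_left_mono) auto
        also have "\<dots> \<le> (2 * \<bar>x + s\<bar>) * (tan \<alpha> / 2)"
        proof (rule mult_right_mono)
          show "\<bar>s\<bar> \<le> 2 * \<bar>x + s\<bar>" using abs_triangle_ineq4[of "x + s" x] False x X by simp
          show "0 \<le> tan \<alpha> / 2" using m(2) m0 by linarith
        qed
        finally show ?thesis by (simp add: z mult_ac)
      qed
      ultimately have "z \<in> double_sector \<alpha>" by (intro mem_double_sector \<alpha>)
      thus ?thesis using \<Omega> unfolding z_def by blast
    qed
  qed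
  thus ?thesis using m m0 that by blast
qed

section \<open>The regularised oscillatory integral on a tilted line\<close>

text \<open>Completing the square. In this way a part of the Gaussian decay absorbs the exponential
  growth of the integrand.\<close>

lemma linear_le_quadratic:
  fixes b s \<eta> :: real
  assumes "\<eta> > 0"
  shows "2 * b * s \<le> \<eta> * s\<^sup>2 + b\<^sup>2 / \<eta>"
proof -
  have "0 \<le> (\<eta> * s - b)\<^sup>2 / \<eta>" using assms by simp
  also have "\<dots> = \<eta> * s\<^sup>2 + b\<^sup>2 / \<eta> - 2 * b * s"
    using assms by (simp add: power2_eq_square field_simps)
  finally show ?thesis by simp
qed

text \<open>On the line of slope \<open>m\<close> the phase supplies Gaussian decay independent of
  \<epsilon>, so dominated convergence gives the limit. The factor 2 bounds the norm of
  \<open>Complex 1 m\<close>. The constant shows its dependence on \<open>M\<close> and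
  \<open>a\<close> explicitly, for later uniformity as \<open>t\<close> tends to 0.\<close>

lemma tilted_gaussian_limit:
  fixes h :: "complex \<Rightarrow> complex" and a b m x M :: real
  assumes hol: "h holomorphic_on \<Omega>"
    and wedge: "\<And>s \<mu>. 0 \<le> \<mu> \<Longrightarrow> \<mu> \<le> m \<Longrightarrow> of_real x + of_real s * Complex 1 \<mu> \<in> \<Omega>"
    and m: "0 < m" "m \<le> 1 / 2" and a: "0 < a" and M: "0 \<le> M" and b: "0 \<le> b"
    and bnd: "\<And>z. z \<in> \<Omega> \<Longrightarrow> norm (h z) \<le> M * exp (b * norm z)"
  defines "f \<equiv> \<lambda>\<epsilon> y. of_real (exp (- \<epsilon> * y\<^sup>2)) *
      (exp (\<i> * of_real a * (of_real y - of_real x)\<^sup>2) * h (of_real y))"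
  shows "\<And>\<epsilon>. \<epsilon> > 0 \<Longrightarrow> integrable lborel (f \<epsilon>)"
    and "\<exists>L. ((\<lambda>\<epsilon>. LINT y|lborel. f \<epsilon> y) \<longlongrightarrow> L) (at_right 0) \<and>
             norm L \<le> M * (2 * exp (b * \<bar>x\<bar> + b\<^sup>2 / (a * m)) * sqrt (pi / (a * m)))"
proof -
  define g where "g = (\<lambda>\<epsilon> z. exp (- of_real \<epsilon> * z\<^sup>2) * (exp (\<i> * of_real a * (z - of_real x)\<^sup>2) * h z))"
  \<comment> \<open>Slope \<mu> = 0 is the original real line and \<mu> = \<open>m\<close> the final
    one.\<close>
  define q where "q = (\<lambda>s \<mu>. of_real x + of_real s * Complex 1 \<mu>)"
  have fg: "f \<epsilon> y = g \<epsilon> (of_real y)" for \<epsilon> y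
    by (simp add: f_def g_def exp_of_real[symmetric])
  have qRe: "Re (q s \<mu>) = x + s" and qIm: "Im (q s \<mu>) = s * \<mu>" for s \<mu>
    by (auto simp: q_def)
  have q\<Omega>: "q s \<mu> \<in> \<Omega>" if "0 \<le> \<mu>" "\<mu> \<le> m" for s \<mu> using wedge[OF that] by (simp add: q_def)
  have g_hol: "g \<epsilon> holomorphic_on \<Omega>" for \<epsilon>
    unfolding g_def by (intro holomorphic_intros hol)
  \<comment> \<open>The exponent collects the real parts of the regulariser and of the phase, and
    the growth \<open>b * norm z\<close>, where the norm of \<open>Complex 1 \<mu>\<close> is at
    most 2.\<close>
  have main: "norm (g \<epsilon> (q s \<mu>)) \<le> M * exp (- \<epsilon> * ((x + s)\<^sup>2 - (s * \<mu>)\<^sup>2) - 2 * a * \<mu> * s\<^sup>2 + b * \<bar>x\<bar> + 2 * b * \<bar>s\<bar>)"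
    if \<mu>: "0 \<le> \<mu>" "\<mu> \<le> m" for \<epsilon> s \<mu>
  proof -
    have 1: "Re (- of_real \<epsilon> * (q s \<mu>)\<^sup>2) = - \<epsilon> * ((x + s)\<^sup>2 - (s * \<mu>)\<^sup>2)"
      by (simp add: Re_power2 qRe qIm)
    have 2: "Re (\<i> * of_real a * (q s \<mu> - of_real x)\<^sup>2) = - (2 * a * \<mu> * s\<^sup>2)"
      by (simp add: Im_power2 qRe qIm power2_eq_square)
    have "norm (Complex 1 \<mu>) \<le> 2" using cmod_le[of "Complex 1 \<mu>"] \<mu> m by simp
    hence "norm (q s \<mu>) \<le> \<bar>x\<bar> + \<bar>s\<bar> * 2"
      unfolding q_def using \<mu> m
      by (intro order_trans[OF norm_triangle_ineq] add_mono) (auto simp: norm_mult intro!: mult_left_mono)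
    hence "b * norm (q s \<mu>) \<le> b * \<bar>x\<bar> + 2 * b * \<bar>s\<bar>"
      using mult_left_mono[OF _ b] by (fastforce simp: algebra_simps)
    hence "norm (h (q s \<mu>)) \<le> M * exp (b * \<bar>x\<bar> + 2 * b * \<bar>s\<bar>)"
      using M by (intro order_trans[OF bnd[OF q\<Omega>[OF \<mu>]]] mult_left_mono) auto
    hence "norm (g \<epsilon> (q s \<mu>)) \<le> exp (- \<epsilon> * ((x + s)\<^sup>2 - (s * \<mu>)\<^sup>2)) * (exp (- (2 * a * \<mu> * s\<^sup>2)) * (M * exp (b * \<bar>x\<bar> + 2 * b * \<bar>s\<bar>)))"
      unfolding g_def norm_mult norm_exp_eq_Re 1 2 by (intro mult_left_mono) auto
    also have "\<dots> = M * exp (- \<epsilon> * ((x + s)\<^sup>2 - (s * \<mu>)\<^sup>2) - 2 * a * \<mu> * s\<^sup>2 + b * \<bar>x\<bar> + 2 * b * \<bar>s\<bar>)"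
      by (simp add: exp_add[symmetric] exp_diff exp_minus field_simps)
    finally show ?thesis .
  qed
  \<comment> \<open>A bound uniform in the slope, where at \<mu> = 0 only the regulariser decays.
    The slope is at most \<open>1 / 2\<close>, which leaves \<open>\<epsilon> * s^2 / 4\<close>;
    half of it absorbs the linear term.\<close>
  have bnd1: "norm (g \<epsilon> (q s \<mu>)) \<le> M * exp (\<epsilon> * x\<^sup>2 + b * \<bar>x\<bar> + 8 * b\<^sup>2 / \<epsilon>) * exp (- (\<epsilon> / 8) * \<bar>s\<bar>\<^sup>2)"
    if \<epsilon>: "0 < \<epsilon>" and \<mu>: "0 \<le> \<mu>" "\<mu> \<le> m" for \<epsilon> s \<mu>
  proof -
    have "(s * \<mu>)\<^sup>2 \<le> s\<^sup>2 * (1 / 2)\<^sup>2"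
      unfolding power_mult_distrib using \<mu> m by (intro mult_left_mono power_mono) auto
    moreover have "(x + s)\<^sup>2 \<ge> s\<^sup>2 / 2 - x\<^sup>2"
    proof -
      \<comment> \<open>Half of this square is \<open>(x + s)^2 - s^2 / 2 + x^2\<close>.\<close>
      have "0 \<le> (2 * x + s)\<^sup>2" by simp
      thus ?thesis by (simp add: power2_eq_square algebra_simps)
    qed
    ultimately have "(x + s)\<^sup>2 - (s * \<mu>)\<^sup>2 \<ge> s\<^sup>2 / 4 - x\<^sup>2" by (simp add: power_divide)
    hence "\<epsilon> * ((x + s)\<^sup>2 - (s * \<mu>)\<^sup>2) \<ge> \<epsilon> * (s\<^sup>2 / 4 - x\<^sup>2)" using \<epsilon> by (intro mult_left_mono) auto
    moreover have "2 * a * \<mu> * s\<^sup>2 \<ge> 0" using a \<mu> by simp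
    moreover have "2 * b * \<bar>s\<bar> \<le> \<epsilon> / 8 * s\<^sup>2 + 8 * b\<^sup>2 / \<epsilon>"
      using linear_le_quadratic[of "\<epsilon> / 8" b "\<bar>s\<bar>"] \<epsilon> by simp
    ultimately have "- \<epsilon> * ((x + s)\<^sup>2 - (s * \<mu>)\<^sup>2) - 2 * a * \<mu> * s\<^sup>2 + b * \<bar>x\<bar> + 2 * b * \<bar>s\<bar>
      \<le> (\<epsilon> * x\<^sup>2 + b * \<bar>x\<bar> + 8 * b\<^sup>2 / \<epsilon>) + (- (\<epsilon> / 8) * \<bar>s\<bar>\<^sup>2)" by (simp add: algebra_simps)
    hence "norm (g \<epsilon> (q s \<mu>)) \<le> M * exp ((\<epsilon> * x\<^sup>2 + b * \<bar>x\<bar> + 8 * b\<^sup>2 / \<epsilon>) + (- (\<epsilon> / 8) * \<bar>s\<bar>\<^sup>2))"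
      using M by (intro order_trans[OF main[OF \<mu>]] mult_left_mono) auto
    thus ?thesis by (simp only: exp_add mult.assoc)
  qed
  have meas: "(\<lambda>s. g \<epsilon> (q s \<mu>)) \<in> borel_measurable lborel" if \<mu>: "0 \<le> \<mu>" "\<mu> \<le> m" for \<epsilon> \<mu>
  proof -
    have "continuous_on UNIV (\<lambda>s. g \<epsilon> (q s \<mu>))"
      by (rule continuous_on_compose2[OF holomorphic_on_imp_continuous_on[OF g_hol]])
         (use wedge[OF \<mu>] in \<open>auto simp: q_def[abs_def] intro!: continuous_intros\<close>)
    thus ?thesis by (simp add: borel_measurable_continuous_onI)
  qed
  have gauss: "integrable lborel (\<lambda>s. D * exp (- \<eta> * s\<^sup>2))" if "\<eta> > 0" for D \<eta> :: real
    using has_bochner_integral_gaussian[OF that] by (auto simp: has_bochner_integral_iff)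
  have intg: "integrable lborel (\<lambda>s. g \<epsilon> (q s \<mu>))" if \<epsilon>: "0 < \<epsilon>" and \<mu>: "0 \<le> \<mu>" "\<mu> \<le> m" for \<epsilon> \<mu>
  proof (rule Bochner_Integration.integrable_bound[OF gauss[of "\<epsilon> / 8" "M * exp (\<epsilon> * x\<^sup>2 + b * \<bar>x\<bar> + 8 * b\<^sup>2 / \<epsilon>)"] meas[OF \<mu>]])
    show "AE s in lborel. norm (g \<epsilon> (q s \<mu>)) \<le> norm (M * exp (\<epsilon> * x\<^sup>2 + b * \<bar>x\<bar> + 8 * b\<^sup>2 / \<epsilon>) * exp (- (\<epsilon> / 8) * s\<^sup>2))"
      using bnd1[OF that] M by (intro AE_I2) (simp add: abs_mult)
  qed (use \<epsilon> in auto)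
  show "integrable lborel (f \<epsilon>)" if \<epsilon>: "\<epsilon> > 0" for \<epsilon>
  proof -
    have "integrable lborel (\<lambda>y. g \<epsilon> (q ((- x) + 1 * y) 0))"
      using m by (intro lborel_integrable_real_affine intg \<epsilon>) auto
    thus ?thesis by (simp add: q_def fg[abs_def] complex_eq_iff[of "Complex 1 0" 1, simplified])
  qed
  have w1: "Complex 1 0 = 1" by (simp add: complex_eq_iff)
  have rot: "(LINT y|lborel. f \<epsilon> y) = Complex 1 m * (LINT s|lborel. g \<epsilon> (q s m))" if \<epsilon>: "\<epsilon> > 0" for \<epsilon>
  proof -
    \<comment> \<open>The chord between the two directions runs through the slopes
      \<open>\<tau> * m\<close>, so every swept point has the form \<open>q s \<mu>\<close>.\<close>
    have dir: "of_real x + of_real s * (of_real (1 - \<tau>) * 1 + of_real \<tau> * Complex 1 m) = q s (\<tau> * m)" for s \<tau>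
      by (simp add: q_def complex_eq_iff algebra_simps)
    have \<tau>m: "0 \<le> \<tau> * m" "\<tau> * m \<le> m" if "\<tau> \<in> {0..1}" for \<tau>
      using that m by (auto simp: mult_left_le_one_le)
    have "(LINT y|lborel. f \<epsilon> y) = (LINT s|lborel. g \<epsilon> (of_real x + of_real s * 1))"
      unfolding fg by (subst lborel_integral_real_affine[of 1 _ x]) auto
    also have "\<dots> = 1 * \<dots>" by simp
    also have "\<dots> = Complex 1 m * (LINT s|lborel. g \<epsilon> (of_real x + of_real s * Complex 1 m))"
    proof (rule line_rotation[OF g_hol])
      let ?D = "M * exp (\<epsilon> * x\<^sup>2 + b * \<bar>x\<bar> + 8 * b\<^sup>2 / \<epsilon>)"
      fix s \<tau> :: real assume \<tau>: "\<tau> \<in> {0..1}"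
      show "of_real x + of_real s * (of_real (1 - \<tau>) * 1 + of_real \<tau> * Complex 1 m) \<in> \<Omega>"
        unfolding dir using \<tau>m[OF \<tau>] q\<Omega> by blast
      show "norm (g \<epsilon> (of_real x + of_real s * (of_real (1 - \<tau>) * 1 + of_real \<tau> * Complex 1 m)))
          \<le> ?D * exp (- (\<epsilon> / 8) * \<bar>s\<bar>\<^sup>2)"
        unfolding dir by (rule bnd1[OF \<epsilon> \<tau>m[OF \<tau>]])
    next
      let ?D = "M * exp (\<epsilon> * x\<^sup>2 + b * \<bar>x\<bar> + 8 * b\<^sup>2 / \<epsilon>)"
      have "((\<lambda>s. s * exp (- (\<epsilon> / 8) * s\<^sup>2)) \<longlongrightarrow> 0) at_top"
        using \<epsilon> by real_asymp
      from tendsto_mult_right_zero[OF this, of ?D]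
      show "((\<lambda>s. s * (?D * exp (- (\<epsilon> / 8) * s\<^sup>2))) \<longlongrightarrow> 0) at_top" by (simp add: mult_ac)
    next
      show "integrable lborel (\<lambda>s. g \<epsilon> (of_real x + of_real s * 1))"
        using intg[OF \<epsilon>, of 0] m by (simp add: q_def w1)
      show "integrable lborel (\<lambda>s. g \<epsilon> (of_real x + of_real s * Complex 1 m))"
        using intg[OF \<epsilon>, of m] m by (simp add: q_def)
    qed
    finally show ?thesis by (simp add: q_def)
  qed
  have am: "a * m > 0" using a m by simp
  \<comment> \<open>The dominating function. Off the real line the regulariser may grow, but for
    \<epsilon> \<le> \<open>a\<close> and \<open>m \<le> 1 / 2\<close> it uses at most
    \<open>a * m / 2\<close> of the decay rate \<open>2 * a * m\<close>. The linear term takes as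
    much again, and \<open>a * m\<close> remains.\<close>
  have bnd2: "norm (g \<epsilon> (q s m)) \<le> M * exp (b * \<bar>x\<bar> + 2 * b\<^sup>2 / (a * m)) * exp (- (a * m) * s\<^sup>2)"
    if \<epsilon>: "0 \<le> \<epsilon>" "\<epsilon> \<le> a" for \<epsilon> s
  proof -
    have "\<epsilon> * m\<^sup>2 \<le> a * (m * (1 / 2))"
      unfolding power2_eq_square using \<epsilon> m a by (intro mult_mono) auto
    hence "\<epsilon> * m\<^sup>2 * s\<^sup>2 \<le> (a * (m * (1 / 2))) * s\<^sup>2" by (intro mult_right_mono) auto
    moreover have "0 \<le> \<epsilon> * (x + s)\<^sup>2" using \<epsilon> by simp
    moreover have "2 * b * \<bar>s\<bar> \<le> a * m / 2 * s\<^sup>2 + 2 * b\<^sup>2 / (a * m)"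
      using linear_le_quadratic[of "a * m / 2" b "\<bar>s\<bar>"] am by (simp add: field_simps)
    ultimately have "- \<epsilon> * ((x + s)\<^sup>2 - (s * m)\<^sup>2) - 2 * a * m * s\<^sup>2 + b * \<bar>x\<bar> + 2 * b * \<bar>s\<bar>
       \<le> (b * \<bar>x\<bar> + 2 * b\<^sup>2 / (a * m)) + (- (a * m) * s\<^sup>2)"
      by (simp add: power_mult_distrib right_diff_distrib mult_ac)
    hence "norm (g \<epsilon> (q s m)) \<le> M * exp ((b * \<bar>x\<bar> + 2 * b\<^sup>2 / (a * m)) + (- (a * m) * s\<^sup>2))"
      using M m by (intro order_trans[OF main] mult_left_mono) auto
    thus ?thesis by (simp only: exp_add mult.assoc)
  qed
  \<comment> \<open>At \<epsilon> = 0 nothing is lost to the regulariser, so the linear term may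
    take all of \<open>a * m\<close>; this gives the constant in the claim.\<close>
  have bnd3: "norm (g 0 (q s m)) \<le> M * exp (b * \<bar>x\<bar> + b\<^sup>2 / (a * m)) * exp (- (a * m) * s\<^sup>2)" for s
  proof -
    have "2 * b * \<bar>s\<bar> \<le> a * m * s\<^sup>2 + b\<^sup>2 / (a * m)"
      using linear_le_quadratic[of "a * m" b "\<bar>s\<bar>"] am by simp
    hence "- 0 * ((x + s)\<^sup>2 - (s * m)\<^sup>2) - 2 * a * m * s\<^sup>2 + b * \<bar>x\<bar> + 2 * b * \<bar>s\<bar>
       \<le> (b * \<bar>x\<bar> + b\<^sup>2 / (a * m)) + (- (a * m) * s\<^sup>2)" by simp
    hence "norm (g 0 (q s m)) \<le> M * exp ((b * \<bar>x\<bar> + b\<^sup>2 / (a * m)) + (- (a * m) * s\<^sup>2))"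
      using M m by (intro order_trans[OF main] mult_left_mono) auto
    thus ?thesis by (simp only: exp_add mult.assoc)
  qed
  let ?I = "LINT s|lborel. g 0 (q s m)"
  \<comment> \<open>With \<epsilon> = \<open>inverse t\<close> the one-sided limit at 0 becomes a
    limit at infinity, to which dominated convergence applies.\<close>
  have "((\<lambda>\<epsilon>. LINT s|lborel. g \<epsilon> (q s m)) \<longlongrightarrow> ?I) (at_right 0)"
    unfolding filterlim_at_right_to_top
  proof (rule integral_dominated_convergence_at_top[OF _ _ gauss[OF am]])
    show "(\<lambda>s. g 0 (q s m)) \<in> borel_measurable lborel" using meas m by auto
    show "\<And>t. (\<lambda>s. g (inverse t) (q s m)) \<in> borel_measurable lborel" using meas m by auto
    show "AE s in lborel. ((\<lambda>t. g (inverse t) (q s m)) \<longlongrightarrow> g 0 (q s m)) at_top"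
      unfolding g_def by (intro AE_I2 tendsto_intros tendsto_of_real tendsto_inverse_0_at_top filterlim_ident)
    show "\<forall>\<^sub>F t in at_top. AE s in lborel. norm (g (inverse t) (q s m))
        \<le> M * exp (b * \<bar>x\<bar> + 2 * b\<^sup>2 / (a * m)) * exp (- (a * m) * s\<^sup>2)"
      using eventually_ge_at_top[of "inverse a"]
    proof eventually_elim
      case (elim t)
      have "t > 0" using elim a less_le_trans[of 0 "inverse a" t] by simp
      hence "0 \<le> inverse t" "inverse t \<le> a" using elim a by (auto simp: field_simps)
      thus ?case using bnd2 by (intro AE_I2)
    qed
  qed
  hence "((\<lambda>\<epsilon>. Complex 1 m * (LINT s|lborel. g \<epsilon> (q s m))) \<longlongrightarrow> Complex 1 m * ?I) (at_right 0)"
    by (intro tendsto_intros)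
  hence lim: "((\<lambda>\<epsilon>. LINT y|lborel. f \<epsilon> y) \<longlongrightarrow> Complex 1 m * ?I) (at_right 0)"
    by (rule Lim_transform_eventually) (use eventually_at_right_less[of 0] rot in \<open>auto elim: eventually_mono\<close>)
  have "norm ?I \<le> (LINT s|lborel. norm (g 0 (q s m)))" by (rule integral_norm_bound)
  also have "\<dots> \<le> (LINT s|lborel. M * exp (b * \<bar>x\<bar> + b\<^sup>2 / (a * m)) * exp (- (a * m) * s\<^sup>2))"
    by (rule integral_mono') (use gauss[OF am] bnd3 M in auto)
  also have "\<dots> = M * exp (b * \<bar>x\<bar> + b\<^sup>2 / (a * m)) * sqrt (pi / (a * m))"
    using has_bochner_integral_gaussian[OF am] by (simp add: has_bochner_integral_iff)
  finally have I: "norm ?I \<le> M * exp (b * \<bar>x\<bar> + b\<^sup>2 / (a * m)) * sqrt (pi / (a * m))" .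
  have "norm (Complex 1 m) \<le> 2" using cmod_le[of "Complex 1 m"] m by simp
  hence "norm (Complex 1 m * ?I) \<le> 2 * (M * exp (b * \<bar>x\<bar> + b\<^sup>2 / (a * m)) * sqrt (pi / (a * m)))"
    unfolding norm_mult using I by (intro mult_mono) auto
  with lim show "\<exists>L. ((\<lambda>\<epsilon>. LINT y|lborel. f \<epsilon> y) \<longlongrightarrow> L) (at_right 0) \<and>
             norm L \<le> M * (2 * exp (b * \<bar>x\<bar> + b\<^sup>2 / (a * m)) * sqrt (pi / (a * m)))"
    by (intro exI[of _ "Complex 1 m * ?I"]) (simp add: mult_ac)
qed

section \<open>A lower bound for the coefficient of the phase\<close>

lemma loc_ac_on_imp_continuous_on:
  assumes f: "loc_ac_on I f" and cd: "{c..d} \<subseteq> I"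
  shows "continuous_on {c..d} f"
  unfolding continuous_on_iff
proof (intro ballI allI impI)
  fix x and \<epsilon> :: real assume x: "x \<in> {c..d}" and "\<epsilon> > 0"
  have "ac_on {c..d} f" using f cd by (simp add: loc_ac_on_def)
  from this[unfolded ac_on_def, THEN spec, THEN mp, OF \<open>\<epsilon> > 0\<close>]
  obtain \<delta> where \<delta>: "\<delta> > 0" and H: "\<forall>(n::nat) (a::nat \<Rightarrow> real) b. (\<forall>k<n. a k \<le> b k \<and> {a k..b k} \<subseteq> {c..d}) \<and>
       (\<forall>j<n. \<forall>k<n. j \<noteq> k \<longrightarrow> {a j<..<b j} \<inter> {a k<..<b k} = {}) \<and>
       (\<Sum>k<n. b k - a k) < \<delta> \<longrightarrow> (\<Sum>k<n. norm (f (b k) - f (a k))) < \<epsilon>"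
    by (elim exE conjE) (rule that)
  \<comment> \<open>Absolute continuity for a family of one interval, \<open>n = 1\<close>.\<close>
  have *: "norm (f v - f u) < \<epsilon>" if "u \<le> v" "u \<in> {c..d}" "v \<in> {c..d}" "v - u < \<delta>" for u v
    using H[THEN spec[of _ 1], THEN spec[of _ "\<lambda>_. u"], THEN spec[of _ "\<lambda>_. v"]] that by auto
  have "dist (f y) (f x) < \<epsilon>" if "y \<in> {c..d}" "dist y x < \<delta>" for y
    using *[of x y] *[of y x] that x
    by (cases "x \<le> y") (auto simp: dist_norm norm_minus_commute)
  thus "\<exists>\<delta>>0. \<forall>y\<in>{c..d}. dist y x < \<delta> \<longrightarrow> dist (f y) (f x) < \<epsilon>" using \<delta> by blast
qed

text \<open>Near 0 the function is at least 1 because it tends to infinity; on the remaining compact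
  interval it is continuous and attains a positive minimum. The bound keeps
  \<open>b^2 / (a t * m)\<close> under control uniformly in \<open>t\<close>.\<close>

lemma positive_lower_bound_near_0:
  fixes a :: "real \<Rightarrow> real"
  assumes pos: "\<And>t. 0 < t \<Longrightarrow> ereal t < T \<Longrightarrow> 0 < a t"
    and ac: "loc_ac_on {t. 0 < t \<and> ereal t < T} a"
    and top: "filterlim a at_top (at_right 0)"
    and r: "ereal r < T"
  obtains a0 where "0 < a0" "\<And>t. 0 < t \<Longrightarrow> t \<le> r \<Longrightarrow> a0 \<le> a t"
proof -
  have "\<forall>\<^sub>F t in at_right 0. 1 \<le> a t" using top by (auto simp: filterlim_at_top)
  then obtain e where e: "e > 0" "\<And>t. 0 < t \<Longrightarrow> t < e \<Longrightarrow> 1 \<le> a t"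
    by (auto simp: eventually_at_right_field)
  have sub: "{e..r} \<subseteq> {t. 0 < t \<and> ereal t < T}"
    using e r by (auto intro: le_less_trans[of "ereal _" "ereal r"])
  show ?thesis
  proof (cases "e \<le> r")
    case True
    obtain t0 where t0: "t0 \<in> {e..r}" "\<And>t. t \<in> {e..r} \<Longrightarrow> a t0 \<le> a t"
      using continuous_attains_inf[OF compact_Icc _ loc_ac_on_imp_continuous_on[OF ac sub]] True by auto
    have "0 < a t0" using pos sub t0(1) by blast
    moreover have "min 1 (a t0) \<le> a t" if "0 < t" "t \<le> r" for t
      using e(2)[of t] t0(2)[of t] that by (cases "t < e") auto
    ultimately show ?thesis using that[of "min 1 (a t0)"] by simp
  next
    case False
    thus ?thesis using that[of 1] e by auto
  qed
qed

section \<open>Convergence, local bounds and linearity of \<open>Psi\<close>\<close>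

definition exp_bounded_on :: "complex set \<Rightarrow> real \<Rightarrow> real \<Rightarrow> (complex \<Rightarrow> complex) \<Rightarrow> bool" where
  "exp_bounded_on \<Omega> M b F \<longleftrightarrow> F holomorphic_on \<Omega> \<and> 0 \<le> M \<and> 0 \<le> b \<and> (\<forall>z\<in>\<Omega>. norm (F z) \<le> M * exp (b * norm z))"

definition Psi_reg :: "(real \<Rightarrow> real \<Rightarrow> complex \<Rightarrow> complex) \<Rightarrow> (complex \<Rightarrow> complex)
    \<Rightarrow> real \<Rightarrow> real \<Rightarrow> real \<Rightarrow> real \<Rightarrow> complex" where
  "Psi_reg G F t x \<epsilon> y =
     complex_of_real (exp (- \<epsilon> * y\<^sup>2)) * G t x (complex_of_real y) * F (complex_of_real y)"

text \<open>\<open>Lim\<close> is a definite description, so its value is known only once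
  convergence has been shown.\<close>

lemma Psi_eqI:
  assumes "t \<noteq> 0" "((\<lambda>\<epsilon>. LINT y|lborel. Psi_reg G F t x \<epsilon> y) \<longlongrightarrow> L) (at_right 0)"
  shows "Psi G F t x = L"
  using assms by (simp add: Psi_def Psi_reg_def tendsto_Lim)

text \<open>One slope \<open>m\<close> and one constant per growth rate \<open>b\<close> serve all
  of \<open>K\<close>, even where \<open>K\<close> touches \<open>t = 0\<close>. Integrability and
  convergence are part of the conclusion because linearity of \<open>Psi\<close> rests on
  them.\<close>

lemma Psi_bound_on_compact:
  assumes SG: "standing_G T V \<alpha> \<Omega> G" and K: "compact K" "K \<subseteq> cstrip T"
  obtains D where "\<And>b. 0 \<le> D b"
    "\<And>t x b M F. (t, x) \<in> K \<Longrightarrow> t \<noteq> 0 \<Longrightarrow> exp_bounded_on \<Omega> M b F \<Longrightarrow>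
        (\<forall>\<epsilon>>0. integrable lborel (Psi_reg G F t x \<epsilon>)) \<and>
        ((\<lambda>\<epsilon>. LINT y|lborel. Psi_reg G F t x \<epsilon> y) \<longlongrightarrow> Psi G F t x) (at_right 0) \<and>
        norm (Psi G F t x) \<le> M * D b"
proof -
  from SG have G_hol: "\<forall>t x. (t, x) \<in> strip T \<longrightarrow> G t x holomorphic_on \<Omega>"
    and T: "T > 0" and \<alpha>: "0 < \<alpha>" "\<alpha> < pi / 2" and \<Omega>: "open \<Omega>" "double_sector \<alpha> \<subseteq> \<Omega>"
    unfolding standing_G_def by - (elim conjE, assumption)+
  from SG obtain a :: "real \<Rightarrow> real" and Gt A0 B0 and A0' B0' :: "real \<times> real \<Rightarrow> real" where
        a: "\<forall>t. 0 < t \<and> ereal t < T \<longrightarrow> a t > 0" "loc_ac_on {t. 0 < t \<and> ereal t < T} a"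
           "filterlim a at_top (at_right 0)"
    and Gt: "\<forall>t x z. (t, x) \<in> strip T \<and> z \<in> \<Omega> \<longrightarrow>
           G t x z = exp (\<i> * complex_of_real (a t) * (z - complex_of_real x)\<^sup>2) * Gt t x z \<and>
           norm (Gt t x z) \<le> A0 t x * exp (B0 t x * norm z)"
    and nn: "\<forall>t x. (t, x) \<in> strip T \<longrightarrow> A0 t x \<ge> 0 \<and> B0 t x \<ge> 0"
    and A0': "continuous_on (cstrip T) A0'" "\<forall>t x. (t, x) \<in> strip T \<longrightarrow> A0' (t, x) = A0 t x / sqrt (a t)"
    and B0': "continuous_on (cstrip T) B0'" "\<forall>t x. (t, x) \<in> strip T \<longrightarrow> B0' (t, x) = B0 t x"
    unfolding standing_G_def by (elim conjE exE) (rule that; assumption)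
  note G_hol = G_hol[rule_format] and a = a[rule_format] and Gt = Gt[rule_format] and nn = nn[rule_format]
    and A0' = A0'[rule_format] and B0' = B0'[rule_format]
  have bdd: "\<exists>c\<ge>0. \<forall>p\<in>K. f p \<le> c" if "continuous_on K f" for f :: "real \<times> real \<Rightarrow> real"
  proof -
    have "bounded (f ` K)" using compact_continuous_image[OF that K(1)] compact_imp_bounded by blast
    then obtain c where "\<forall>p\<in>K. norm (f p) \<le> c" by (auto simp: bounded_iff)
    thus ?thesis by (intro exI[of _ "max c 0"]) (auto simp: le_max_iff_disj abs_le_iff)
  qed
  \<comment> \<open>The continuous extensions are bounded rather than \<open>A0 / sqrt a\<close> and
    \<open>B0\<close> themselves, since \<open>K\<close> may contain points with
    \<open>t = 0\<close>.\<close>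
  obtain \<alpha>1 where \<alpha>1: "\<alpha>1 \<ge> 0" "\<And>p. p \<in> K \<Longrightarrow> A0' p \<le> \<alpha>1"
    using bdd continuous_on_subset[OF A0'(1) K(2)] by blast
  obtain \<beta>1 where \<beta>1: "\<beta>1 \<ge> 0" "\<And>p. p \<in> K \<Longrightarrow> B0' p \<le> \<beta>1"
    using bdd continuous_on_subset[OF B0'(1) K(2)] by blast
  obtain X where X: "X \<ge> 0" "\<And>p. p \<in> K \<Longrightarrow> \<bar>snd p\<bar> \<le> X"
  proof -
    have "continuous_on K (\<lambda>p. \<bar>snd p\<bar>)" by (intro continuous_intros)
    from bdd[OF this] that show thesis by blast
  qed
  \<comment> \<open>The largest time in \<open>K\<close> is attained by compactness and hence stays
    below \<open>T\<close>.\<close>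
  obtain r where r: "ereal r < T" "\<And>p. p \<in> K \<Longrightarrow> fst p \<le> r"
  proof (cases "K = {}")
    case True
    have "ereal 0 < T" using T by (simp add: zero_ereal_def)
    thus ?thesis using that[of 0] True by auto
  next
    case False
    obtain p where "p \<in> K" "\<And>q. q \<in> K \<Longrightarrow> fst q \<le> fst p"
      using continuous_attains_sup[OF K(1) False continuous_on_fst[OF continuous_on_id]] by blast
    thus ?thesis using that[of "fst p"] K(2) by (auto simp: cstrip_def)
  qed
  obtain a0 where a0: "0 < a0" "\<And>t. 0 < t \<Longrightarrow> t \<le> r \<Longrightarrow> a0 \<le> a t"
    using positive_lower_bound_near_0[OF a r(1)] by blast
  obtain m where m: "0 < m" "m \<le> 1 / 2"
    "\<And>x s \<mu>. \<bar>x\<bar> \<le> X \<Longrightarrow> 0 \<le> \<mu> \<Longrightarrow> \<mu> \<le> m \<Longrightarrow> of_real x + of_real s * Complex 1 \<mu> \<in> \<Omega>"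
    using tilted_lines_subset[OF \<alpha> \<Omega> X(1)] by blast
  \<comment> \<open>The constant of \<open>tilted_gaussian_limit\<close> with every quantity
    replaced by its bound over \<open>K\<close>; the rate is \<beta>1 + \<open>b\<close> because the
    growth of \<open>Gt\<close> and of \<open>F\<close> multiply.\<close>
  define D where "D = (\<lambda>b. \<alpha>1 * (2 * exp ((\<beta>1 + b) * X + (\<beta>1 + b)\<^sup>2 / (a0 * m)) * sqrt (pi / m)))"
  show ?thesis
  proof (rule that)
    show "0 \<le> D b" for b using \<alpha>1 m by (simp add: D_def)
    fix t x b M F assume p: "(t, x) \<in> K" "t \<noteq> 0" and F: "exp_bounded_on \<Omega> M b F"
    from F have F: "F holomorphic_on \<Omega>" "0 \<le> M" "0 \<le> b" "\<And>z. z \<in> \<Omega> \<Longrightarrow> norm (F z) \<le> M * exp (b * norm z)"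
      by (auto simp: exp_bounded_on_def)
    have tx: "(t, x) \<in> strip T" using p K by (auto simp: strip_def cstrip_def)
    hence t: "0 < t" "ereal t < T" by (auto simp: strip_def)
    have at: "0 < a t" "a0 \<le> a t" using a(1)[OF conjI[OF t]] a0(2) t r(2)[OF p(1)] by auto
    have x: "\<bar>x\<bar> \<le> X" using X(2)[OF p(1)] by simp
    \<comment> \<open>On \<Omega> this is \<open>Gt t x z * F z\<close>. Dividing the phase out of
      \<open>G\<close> makes holomorphy available, as it is assumed for \<open>G\<close> and not for
      \<open>Gt\<close>.\<close>
    define h where "h = (\<lambda>z. exp (- (\<i> * of_real (a t) * (z - of_real x)\<^sup>2)) * G t x z * F z)"
    have f: "Psi_reg G F t x = (\<lambda>\<epsilon> y. of_real (exp (- \<epsilon> * y\<^sup>2)) *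
      (exp (\<i> * of_real (a t) * (of_real y - of_real x)\<^sup>2) * h (of_real y)))"
      by (simp add: h_def Psi_reg_def fun_eq_iff exp_minus)
    have hol: "h holomorphic_on \<Omega>"
      unfolding h_def by (intro holomorphic_intros G_hol[OF tx] F(1))
    have bnd: "norm (h z) \<le> (A0 t x * M) * exp ((B0 t x + b) * norm z)" if z: "z \<in> \<Omega>" for z
    proof -
      have "h z = Gt t x z * F z" using Gt[OF conjI[OF tx z]] by (simp add: h_def exp_minus)
      hence "norm (h z) = norm (Gt t x z) * norm (F z)" by (simp add: norm_mult)
      also have "\<dots> \<le> (A0 t x * exp (B0 t x * norm z)) * (M * exp (b * norm z))"
        using Gt[OF conjI[OF tx z]] F(4)[OF z] nn[OF tx] F(2) by (intro mult_mono) auto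
      also have "\<dots> = (A0 t x * M) * exp ((B0 t x + b) * norm z)"
        by (simp add: exp_add distrib_right)
      finally show ?thesis .
    qed
    have nn': "0 \<le> A0 t x * M" "0 \<le> B0 t x + b" using nn[OF tx] F by auto
    have int: "\<forall>\<epsilon>>0. integrable lborel (Psi_reg G F t x \<epsilon>)" unfolding f
      by (intro allI impI, rule tilted_gaussian_limit(1)[OF hol _ m(1,2) at(1) nn']) (use m(3)[OF x] bnd in auto)
    have "\<exists>L. ((\<lambda>\<epsilon>. LINT y|lborel. Psi_reg G F t x \<epsilon> y) \<longlongrightarrow> L) (at_right 0) \<and>
      norm L \<le> (A0 t x * M) * (2 * exp ((B0 t x + b) * \<bar>x\<bar> + (B0 t x + b)\<^sup>2 / (a t * m)) * sqrt (pi / (a t * m)))"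
      unfolding f
      by (rule tilted_gaussian_limit(2)[OF hol _ m(1,2) at(1) nn']) (use m(3)[OF x] bnd in auto)
    then obtain L where lim: "((\<lambda>\<epsilon>. LINT y|lborel. Psi_reg G F t x \<epsilon> y) \<longlongrightarrow> L) (at_right 0)"
      and Lb: "norm L \<le> (A0 t x * M) * (2 * exp ((B0 t x + b) * \<bar>x\<bar> + (B0 t x + b)\<^sup>2 / (a t * m)) * sqrt (pi / (a t * m)))"
      by blast
    have Psi: "Psi G F t x = L" using p(2) lim by (rule Psi_eqI)
    have B: "B0 t x \<le> \<beta>1" using \<beta>1(2)[OF p(1)] B0'(2)[OF tx] by simp
    have A: "0 \<le> A0 t x / sqrt (a t)" "A0 t x / sqrt (a t) \<le> \<alpha>1"
      using \<alpha>1(2)[OF p(1)] A0'(2)[OF tx] nn[OF tx] at by auto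
    have "(B0 t x + b)\<^sup>2 / (a t * m) \<le> (\<beta>1 + b)\<^sup>2 / (a0 * m)"
      using at a0 m(1) B nn[OF tx] F by (intro frac_le power_mono mult_right_mono mult_pos_pos) auto
    moreover have "(B0 t x + b) * \<bar>x\<bar> \<le> (\<beta>1 + b) * X"
      using x B nn[OF tx] F \<beta>1 by (intro mult_mono) auto
    ultimately have E: "exp ((B0 t x + b) * \<bar>x\<bar> + (B0 t x + b)\<^sup>2 / (a t * m)) \<le> exp ((\<beta>1 + b) * X + (\<beta>1 + b)\<^sup>2 / (a0 * m))"
      by simp
    note Lb
    \<comment> \<open>The factor \<open>1 / sqrt (a t)\<close> from the Gaussian integral is joined
      to \<open>A0\<close>, giving the quotient that stays bounded as \<open>t\<close> tends to
      0.\<close>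
    also have "(A0 t x * M) * (2 * exp ((B0 t x + b) * \<bar>x\<bar> + (B0 t x + b)\<^sup>2 / (a t * m)) * sqrt (pi / (a t * m)))
      = M * ((A0 t x / sqrt (a t)) * (2 * exp ((B0 t x + b) * \<bar>x\<bar> + (B0 t x + b)\<^sup>2 / (a t * m)) * sqrt (pi / m)))"
      by (simp add: real_sqrt_divide real_sqrt_mult mult_ac)
    also have "\<dots> \<le> M * D b"
      unfolding D_def using A E m F \<alpha>1 by (intro mult_left_mono mult_mono) auto
    finally show "(\<forall>\<epsilon>>0. integrable lborel (Psi_reg G F t x \<epsilon>)) \<and>
        ((\<lambda>\<epsilon>. LINT y|lborel. Psi_reg G F t x \<epsilon> y) \<longlongrightarrow> Psi G F t x) (at_right 0) \<and>
        norm (Psi G F t x) \<le> M * D b"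
      using lim int unfolding Psi by blast
  qed
qed

text \<open>The exponential bounds make every regularised integral exist and converge, so finite
  sums pass first through the integral and then through the limit.\<close>

lemma Psi_sum:
  assumes SG: "standing_G T V \<alpha> \<Omega> G" and p: "(t, x) \<in> cstrip T"
    and F: "\<And>i. i \<in> I \<Longrightarrow> exp_bounded_on \<Omega> (M i) (b i) (F i)"
  shows "Psi G (\<lambda>z. \<Sum>i\<in>I. C i * F i z) t x = (\<Sum>i\<in>I. C i * Psi G (F i) t x)"
proof (cases "t = 0")
  case True
  thus ?thesis by (simp add: Psi_def)
next
  case False
  \<comment> \<open>A one-point compact set suffices, as only integrability and convergence are
    wanted here.\<close>
  have "compact {(t, x)}" "{(t, x)} \<subseteq> cstrip T" using p by auto
  from Psi_bound_on_compact[OF SG this] obtain D where D: "\<And>t' x' b M F. (t', x') \<in> {(t, x)} \<Longrightarrow> t' \<noteq> 0 \<Longrightarrow>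
        exp_bounded_on \<Omega> M b F \<Longrightarrow> (\<forall>\<epsilon>>0. integrable lborel (Psi_reg G F t' x' \<epsilon>)) \<and>
        ((\<lambda>\<epsilon>. LINT y|lborel. Psi_reg G F t' x' \<epsilon> y) \<longlongrightarrow> Psi G F t' x') (at_right 0) \<and>
        norm (Psi G F t' x') \<le> M * D b" by metis
  note D = D[OF singletonI False]
  have "((\<lambda>\<epsilon>. \<Sum>i\<in>I. C i * (LINT y|lborel. Psi_reg G (F i) t x \<epsilon> y)) \<longlongrightarrow> (\<Sum>i\<in>I. C i * Psi G (F i) t x)) (at_right 0)"
    using D[OF F] by (intro tendsto_intros) auto
  moreover have "\<forall>\<^sub>F \<epsilon> in at_right 0. (\<Sum>i\<in>I. C i * (LINT y|lborel. Psi_reg G (F i) t x \<epsilon> y))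
      = (LINT y|lborel. Psi_reg G (\<lambda>z. \<Sum>i\<in>I. C i * F i z) t x \<epsilon> y)"
    using eventually_at_right_less[of 0]
  proof eventually_elim
    case (elim \<epsilon>)
    have "(LINT y|lborel. Psi_reg G (\<lambda>z. \<Sum>i\<in>I. C i * F i z) t x \<epsilon> y)
        = (LINT y|lborel. (\<Sum>i\<in>I. C i * Psi_reg G (F i) t x \<epsilon> y))"
      by (simp add: Psi_reg_def sum_distrib_left sum_distrib_right mult_ac)
    also have "\<dots> = (\<Sum>i\<in>I. C i * (LINT y|lborel. Psi_reg G (F i) t x \<epsilon> y))"
      using D[OF F] elim by (subst Bochner_Integration.integral_sum) auto
    finally show ?case ..
  qed
  ultimately have "((\<lambda>\<epsilon>. LINT y|lborel. Psi_reg G (\<lambda>z. \<Sum>i\<in>I. C i * F i z) t x \<epsilon> y)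
      \<longlongrightarrow> (\<Sum>i\<in>I. C i * Psi G (F i) t x)) (at_right 0)"
    by (rule Lim_transform_eventually)
  thus ?thesis using False by (intro Psi_eqI)
qed

section \<open>Uniform convergence on compact sets\<close>

theorem theorem4p5:
  fixes T :: ereal and V :: "real \<Rightarrow> real \<Rightarrow> complex" and \<alpha> :: real
    and \<Omega> :: "complex set" and G :: "real \<Rightarrow> real \<Rightarrow> complex \<Rightarrow> complex"
    and U Ob :: "complex set" and \<phi> :: "complex \<Rightarrow> complex \<Rightarrow> complex"
    and A B :: "complex \<Rightarrow> real"
    and C :: "nat \<Rightarrow> nat \<Rightarrow> complex" and \<kappa>s :: "nat \<Rightarrow> nat \<Rightarrow> complex"
    and \<kappa> :: complex and c :: real
  assumes SG: "standing_G T V \<alpha> \<Omega> G"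
    and UO: "U \<subset> Ob"
    and hol: "\<And>k. k \<in> Ob \<Longrightarrow> \<phi> k holomorphic_on \<Omega>"
    and A_cont: "continuous_on Ob A" and B_cont: "continuous_on Ob B"
    and A_nn: "\<And>k. k \<in> Ob \<Longrightarrow> A k \<ge> 0" and B_nn: "\<And>k. k \<in> Ob \<Longrightarrow> B k \<ge> 0"
    and bound: "\<And>k z. k \<in> Ob \<Longrightarrow> z \<in> \<Omega> \<Longrightarrow> norm (\<phi> k z) \<le> A k * exp (B k * norm z)"
    and \<kappa>s_U: "\<And>n l. l \<le> n \<Longrightarrow> \<kappa>s l n \<in> U"
    and \<kappa>_in: "\<kappa> \<in> Ob - U"
    and c_nn: "c \<ge> 0"
    and approx: "(\<lambda>n. SUP z\<in>\<Omega>. ereal (norm ((\<Sum>l\<le>n. C l n * \<phi> (\<kappa>s l n) z) - \<phi> \<kappa> z)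
                                         * exp (- c * norm z))) \<longlonglongrightarrow> 0"
  shows "\<forall>K. compact K \<and> K \<subseteq> cstrip T \<longrightarrow>
           uniform_limit K (\<lambda>n (t, x). Psi G (\<lambda>z. \<Sum>l\<le>n. C l n * \<phi> (\<kappa>s l n) z) t x)
                           (\<lambda>(t, x). Psi G (\<phi> \<kappa>) t x) sequentially \<and>
           uniform_limit K (\<lambda>n (t, x). \<Sum>l\<le>n. C l n * Psi G (\<phi> (\<kappa>s l n)) t x)
                           (\<lambda>(t, x). Psi G (\<phi> \<kappa>) t x) sequentially"
proof -
  from SG have \<alpha>: "0 < \<alpha>" "\<alpha> < pi / 2" and \<Omega>: "double_sector \<alpha> \<subseteq> \<Omega>"
    unfolding standing_G_def by - (elim conjE, assumption)+
  define F where "F = (\<lambda>n z. \<Sum>l\<le>n. C l n * \<phi> (\<kappa>s l n) z)"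
  define H where "H = (\<lambda>n z. F n z - \<phi> \<kappa> z)"
  have \<phi>: "exp_bounded_on \<Omega> (A k) (B k) (\<phi> k)" if "k \<in> Ob" for k
    using hol[OF that] A_nn[OF that] B_nn[OF that] bound[OF that] by (simp add: exp_bounded_on_def)
  have \<kappa>s: "\<kappa>s l n \<in> Ob" if "l \<le> n" for l n using \<kappa>s_U[OF that] UO by blast
  have \<kappa>: "\<kappa> \<in> Ob" using \<kappa>_in by blast
  have Psi_F: "Psi G (F n) t x = (\<Sum>l\<le>n. C l n * Psi G (\<phi> (\<kappa>s l n)) t x)"
    if "(t, x) \<in> cstrip T" for n t x
    unfolding F_def using \<phi>[OF \<kappa>s]
    by (intro Psi_sum[OF SG that, of _ "\<lambda>l. A (\<kappa>s l n)" "\<lambda>l. B (\<kappa>s l n)"]) auto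
  have Psi_H: "Psi G (H n) t x = Psi G (F n) t x - Psi G (\<phi> \<kappa>) t x" if p: "(t, x) \<in> cstrip T" for n t x
  proof -
    \<comment> \<open>The difference is a single linear combination with one further term, index
      \<open>Suc n\<close>, coefficient \<open>-1\<close> and function
      \<open>\<phi> \<kappa>\<close>, so that \<open>Psi_sum\<close> covers it.\<close>
    define k c' where "k = (\<lambda>l. if l \<le> n then \<kappa>s l n else \<kappa>)" and "c' = (\<lambda>l. if l \<le> n then C l n else -1)"
    have "k l \<in> Ob" for l using \<kappa>s \<kappa> by (simp add: k_def)
    hence "Psi G (\<lambda>z. \<Sum>l\<le>Suc n. c' l * \<phi> (k l) z) t x = (\<Sum>l\<le>Suc n. c' l * Psi G (\<phi> (k l)) t x)"
      using \<phi> by (intro Psi_sum[OF SG p, of _ "\<lambda>l. A (k l)" "\<lambda>l. B (k l)"]) auto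
    thus ?thesis unfolding Psi_F[OF p] by (simp add: k_def c'_def H_def F_def)
  qed
  have H_hol: "H n holomorphic_on \<Omega>" for n
    unfolding H_def F_def using \<kappa>s \<kappa> hol by (intro holomorphic_intros) auto
  \<comment> \<open>Only the prefactor \<delta> shrinks; the rate \<open>c\<close> is the same for
    all \<open>n\<close>, so the single constant \<open>D c\<close> will do.\<close>
  have H_bound: "\<forall>\<^sub>F n in sequentially. exp_bounded_on \<Omega> \<delta> c (H n)" if \<delta>: "\<delta> > 0" for \<delta>
  proof -
    have "\<forall>\<^sub>F n in sequentially. (SUP z\<in>\<Omega>. ereal (norm (H n z) * exp (- c * norm z))) < ereal \<delta>"
      using order_tendstoD(2)[OF approx, of "ereal \<delta>"] \<delta> by (simp add: H_def F_def)
    thus ?thesis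
    proof eventually_elim
      case (elim n)
      have "norm (H n z) \<le> \<delta> * exp (c * norm z)" if z: "z \<in> \<Omega>" for z
      proof -
        have "ereal (norm (H n z) * exp (- c * norm z)) \<le> (SUP z\<in>\<Omega>. ereal (norm (H n z) * exp (- c * norm z)))"
          by (rule SUP_upper[OF z])
        hence "norm (H n z) * exp (- c * norm z) < \<delta>" using elim le_less_trans by fastforce
        thus ?thesis by (simp add: exp_minus field_simps)
      qed
      thus ?case using H_hol c_nn \<delta> by (simp add: exp_bounded_on_def)
    qed
  qed
  have unif: "uniform_limit K (\<lambda>n (t, x). Psi G (F n) t x) (\<lambda>(t, x). Psi G (\<phi> \<kappa>) t x) sequentially"
    if K: "compact K" "K \<subseteq> cstrip T" for K
  proof -
    obtain D where D: "\<And>b. 0 \<le> D b"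
      "\<And>t x b M F. (t, x) \<in> K \<Longrightarrow> t \<noteq> 0 \<Longrightarrow> exp_bounded_on \<Omega> M b F \<Longrightarrow> norm (Psi G F t x) \<le> M * D b"
      using Psi_bound_on_compact[OF SG K] by metis
    obtain X where X: "\<And>p. p \<in> K \<Longrightarrow> norm p \<le> X"
      using compact_imp_bounded[OF K(1)] by (auto simp: bounded_iff)
    \<comment> \<open>\<open>D c\<close> covers \<open>t > 0\<close>. At \<open>t = 0\<close>, where
      \<open>Psi\<close> is the function itself, \<open>exp (c * X)\<close> bounds its growth on
      \<open>K\<close>.\<close>
    define E where "E = D c + exp (c * X)"
    have E: "E > 0" using D(1)[of c] by (simp add: E_def add_nonneg_pos)
    have bnd: "norm (Psi G (H n) t x) \<le> \<delta> * E" if p: "(t, x) \<in> K" and H: "exp_bounded_on \<Omega> \<delta> c (H n)" for t x n \<delta>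
    proof -
      have \<delta>: "0 \<le> \<delta>" using H by (simp add: exp_bounded_on_def)
      show ?thesis
      proof (cases "t = 0")
        case True
        have "\<bar>x\<bar> \<le> X" using X[OF p] norm_snd_le[of x t] by simp
        hence "\<delta> * exp (c * \<bar>x\<bar>) \<le> \<delta> * E"
          unfolding E_def using \<delta> D(1)[of c] c_nn by (intro mult_left_mono add_increasing) (auto intro: mult_left_mono)
        moreover have "complex_of_real x \<in> \<Omega>" using of_real_mem_double_sector[OF \<alpha>] \<Omega> by blast
        hence "norm (H n (of_real x)) \<le> \<delta> * exp (c * \<bar>x\<bar>)"
          using H unfolding exp_bounded_on_def by (metis norm_of_real)
        ultimately show ?thesis using True by (simp add: Psi_def)
      next
        case False
        have "\<delta> * D c \<le> \<delta> * E" using \<delta> by (simp add: E_def distrib_left)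
        thus ?thesis using D(2)[OF p False H] by simp
      qed
    qed
    show ?thesis
    proof (rule uniform_limitI)
      fix e :: real assume e: "e > 0"
      \<comment> \<open>The factor 2 turns the weak bound \<open>e / 2\<close> into a strict one by
        \<open>e\<close>.\<close>
      have "\<forall>\<^sub>F n in sequentially. exp_bounded_on \<Omega> (e / (2 * E)) c (H n)"
        using e E by (intro H_bound) simp
      thus "\<forall>\<^sub>F n in sequentially. \<forall>p\<in>K. dist (case p of (t, x) \<Rightarrow> Psi G (F n) t x) (case p of (t, x) \<Rightarrow> Psi G (\<phi> \<kappa>) t x) < e"
      proof eventually_elim
        case (elim n)
        show ?case
        proof (clarify)
          fix t x assume p: "(t, x) \<in> K"
          have "dist (Psi G (F n) t x) (Psi G (\<phi> \<kappa>) t x) = norm (Psi G (H n) t x)"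
            using p K by (subst Psi_H) (auto simp: dist_norm)
          also have "\<dots> \<le> e / (2 * E) * E" by (rule bnd[OF p elim])
          also have "\<dots> < e" using e E by simp
          finally show "dist (Psi G (F n) t x) (Psi G (\<phi> \<kappa>) t x) < e" .
        qed
      qed
    qed
  qed
  show ?thesis
  proof (intro allI impI conjI)
    fix K assume K: "compact K \<and> K \<subseteq> cstrip T"
    show "uniform_limit K (\<lambda>n (t, x). Psi G (\<lambda>z. \<Sum>l\<le>n. C l n * \<phi> (\<kappa>s l n) z) t x)
        (\<lambda>(t, x). Psi G (\<phi> \<kappa>) t x) sequentially"
      using unif[of K] K by (simp add: F_def)
    \<comment> \<open>By linearity both sequences agree at every point of \<open>K\<close>, so the
      second limit is the first.\<close>
    have "uniform_limit K (\<lambda>n (t, x). \<Sum>l\<le>n. C l n * Psi G (\<phi> (\<kappa>s l n)) t x)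
        (\<lambda>(t, x). Psi G (\<phi> \<kappa>) t x) sequentially \<longleftrightarrow>
      uniform_limit K (\<lambda>n (t, x). Psi G (F n) t x) (\<lambda>(t, x). Psi G (\<phi> \<kappa>) t x) sequentially"
      using K Psi_F by (intro uniform_limit_cong') auto
    thus "uniform_limit K (\<lambda>n (t, x). \<Sum>l\<le>n. C l n * Psi G (\<phi> (\<kappa>s l n)) t x)
        (\<lambda>(t, x). Psi G (\<phi> \<kappa>) t x) sequentially"
      using unif[of K] K by blast
  qed
qed

end
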